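(* Algorithm 2 (described in the context), when it does not stop, produces a sequence of iterates $(\mathbf x^j,\mathbf y^j,\mathbf s^j)\in\mathcal N_k(\bar\gamma,\underline\gamma,\gamma_p,\gamma_d)$ such that $\lim_{j\to\infty}(\mathbf x^j)^T\mathbf s^j=0$, i.e. $(\mathbf x^j,\mathbf y^j,\mathbf s^j)$ converges to a solution of problem PPM$(k)$.
   Context: Setting. Let $A\in\mathbb R^{m\times n}$ with $m\le n$ (not necessarily of full rank), $\mathbf b\in\mathbb R^m$, $\mathbf c\in\mathbb R^n$, $\rho,\delta>0$, and let $\mathbf x_k\in\mathbb R^n$, $\mathbf y_k\in\mathbb R^m$ be fixed. Problem PPM$(k)$ is: minimize $\mathbf c^T\mathbf x+\frac\rho2\|\mathbf x-\mathbf x_k\|^2+\frac\delta2\|\mathbf y\|^2$ over $\mathbf x\in\mathbb R^n,\mathbf y\in\mathbb R^m$ subject to $A\mathbf x+\delta(\mathbf y-\mathbf y_k)=\mathbf b$, $\mathbf x\ge0$. $\|\cdot\|$ is the Euclidean norm, $\mathbf e$ the all-ones vector. A triple $(\mathbf x^*,\mathbf y^*,\mathbf s^* )$ is a solution of PPM$(k)$ if $A\mathbf x^*+\delta(\mathbf y^*-\mathbf y_k)-\mathbf b=0$, $\rho(\mathbf x^*-\mathbf x_k)-A^T\mathbf y^*-\mathbf s^*+\mathbf c=0$, $(\mathbf x^* )^T\mathbf s^*=0$, and $\mathbf x^*,\mathbf s^*\ge0$. Parameters: $0<\underline\gamma<1<\bar\gamma$, $\gamma_p,\gamma_d>0$,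 $0<\sigma<\bar\sigma<1$, $C_{\text{inexact}}\in(0,1)$ with $\gamma_pC_{\text{inexact}}<\sigma$. Neighbourhood: $\mathcal N_k=\mathcal N_k(\bar\gamma,\underline\gamma,\gamma_p,\gamma_d)$ is the set of $(\mathbf x,\mathbf y,\mathbf s)\in\mathbb R^n_{>0}\times\mathbb R^m\times\mathbb R^n_{>0}$ with $\bar\gamma\,\mathbf x^T\mathbf s/n\ge x_is_i\ge\underline\gamma\,\mathbf x^T\mathbf s/n$ for all $i$, $\mathbf x^T\mathbf s\ge\gamma_p\|A\mathbf x+\delta(\mathbf y-\mathbf y_k)-\mathbf b\|$ and $\mathbf x^T\mathbf s\ge\gamma_d\|\rho(\mathbf x-\mathbf x_k)-A^T\mathbf y-\mathbf s+\mathbf c\|$. Inexact Newton direction at $(\mathbf x,\mathbf y,\mathbf s)$ with $\mathbf x,\mathbf s>0$: put $X=\mathrm{diag}(\mathbf x)$, $S=\mathrm{diag}(\mathbf s)$, $\mu=\mathbf x^T\mathbf s/n$, $\boldsymbol\xi_d=-(\rho(\mathbf x-\mathbf x_k)-A^T\mathbf y-\mathbf s+\mathbf c)$, $\boldsymbol\xi_p=-(A\mathbf x+\delta(\mathbf y-\mathbf y_k)-\mathbf b)$, $\boldsymbol\xi_{\mu,\sigma}=-(SX\mathbf e-\sigma\mu\mathbf e)$. An inexact Newton direction is $(\Delta\mathbf x,\Delta\mathbf y,\Delta\mathbf s)$ with $\rho\Delta\mathbf x-A^T\Delta\mathbf y-\Delta\mathbf s=\boldsymbol\xi_d$, $A\Delta\mathbf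 x+\delta\Delta\mathbf y=\boldsymbol\xi_p+\boldsymbol\zeta$, $S\Delta\mathbf x+X\Delta\mathbf s=\boldsymbol\xi_{\mu,\sigma}$, for some $\boldsymbol\zeta$ with $\|\boldsymbol\zeta\|\le C_{\text{inexact}}\mathbf x^T\mathbf s$. Write $(\mathbf x(\alpha),\mathbf y(\alpha),\mathbf s(\alpha))=(\mathbf x,\mathbf y,\mathbf s)+\alpha(\Delta\mathbf x,\Delta\mathbf y,\Delta\mathbf s)$. Algorithm 2: start from $(\mathbf x^0,\mathbf y^0,\mathbf s^0)\in\mathcal N_k$. At iteration $j$, compute an inexact Newton direction at $(\mathbf x^j,\mathbf y^j,\mathbf s^j)$. Let $\alpha^{*,j}=\min\{\sup\{\alpha:\mathbf x^j(\alpha)\ge0\},\sup\{\alpha:\mathbf s^j(\alpha)\ge0\}\}$; if $\alpha^{*,j}<\infty$ and $(\mathbf x^j(\alpha^{*,j}),\mathbf y^j(\alpha^{*,j}),\mathbf s^j(\alpha^{*,j}))$ is a solution of PPM$(k)$, stop. Otherwise let $\alpha^j$ be the maximum $\alpha\in[0,1]$ such that for all $\alpha'\in[0,\alpha]$: $(\mathbf x^j(\alpha'),\mathbf y^j(\alpha'),\mathbf s^j(\alpha'))\in\mathcal N_k$ and $\mathbf x^j(\alpha')^T\mathbf s^j(\alpha')\le(1-(1-\bar\sigma)\alpha')(\mathbf x^j)^T\mathbf s^j$. Set $(\mathbf x^{j+1},\mathbf y^{j+1},\mathbf s^{j+1})=(\mathbf x^j(\alpha^j),\mathbf y^j(\alpha^j),\mathbf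 s^j(\alpha^j))$ and continue. *)

theory Defs
  imports "HOL-Analysis.Analysis"
begin

text \<open>
  Data of PPM(k): minimise
  \<open>cost \<bullet> x + (prox_rho / 2) \<parallel>x - x_ref\<parallel>\<^sup>2 + (prox_delta / 2) \<parallel>y\<parallel>\<^sup>2\<close>
  subject to \<open>Amat x + prox_delta (y - y_ref) = rhs\<close> and \<open>x \<ge> 0\<close>.
  Here \<open>x_ref\<close> and \<open>y_ref\<close> are the fixed proximal centres $x_k$ and $y_k$.
\<close>

record ('m::finite, 'n::finite) ppm =
  Amat :: "real ^ 'n ^ 'm"
  rhs :: "real ^ 'm"
  cost :: "real ^ 'n"
  prox_rho :: real
  prox_delta :: real
  x_ref :: "real ^ 'n"
  y_ref :: "real ^ 'm"

text \<open>Triples \<open>(x, y, s)\<close>; directions have the same type.\<close>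

type_synonym ('m, 'n) triple = "(real ^ 'n) \<times> (real ^ 'm) \<times> (real ^ 'n)"

definition x_of :: "('m::finite, 'n::finite) triple \<Rightarrow> real ^ 'n" where
  "x_of w = fst w"

definition y_of :: "('m::finite, 'n::finite) triple \<Rightarrow> real ^ 'm" where
  "y_of w = fst (snd w)"

definition s_of :: "('m::finite, 'n::finite) triple \<Rightarrow> real ^ 'n" where
  "s_of w = snd (snd w)"

text \<open>Componentwise; the library's order \<open><\<close> on vectors is not componentwise strict.\<close>

definition nonneg_vec :: "real ^ 'n \<Rightarrow> bool" where
  "nonneg_vec v \<longleftrightarrow> (\<forall>i. 0 \<le> v $ i)"

definition pos_vec :: "real ^ 'n \<Rightarrow> bool" where
  "pos_vec v \<longleftrightarrow> (\<forall>i. 0 < v $ i)"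

definition diag :: "real ^ 'n \<Rightarrow> real ^ 'n ^ 'n" where
  "diag v = (\<chi> i j. if i = j then v $ i else 0)"

definition gap :: "('m::finite, 'n::finite) triple \<Rightarrow> real" where
  "gap w = x_of w \<bullet> s_of w"

definition mu :: "('m::finite, 'n::finite) triple \<Rightarrow> real" where
  "mu w = gap w / real CARD('n)"

definition primal_residual ::
  "('m::finite, 'n::finite) ppm \<Rightarrow> ('m, 'n) triple \<Rightarrow> real ^ 'm" where
  "primal_residual P w =
     Amat P *v x_of w + prox_delta P *\<^sub>R (y_of w - y_ref P) - rhs P"

definition dual_residual ::
  "('m::finite, 'n::finite) ppm \<Rightarrow> ('m, 'n) triple \<Rightarrow> real ^ 'n" where
  "dual_residual P w =
     prox_rho P *\<^sub>R (x_of w - x_ref P) - transpose (Amat P) *v y_of w - s_of w + cost P"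

definition ppm_solution ::
  "('m::finite, 'n::finite) ppm \<Rightarrow> ('m, 'n) triple \<Rightarrow> bool" where
  "ppm_solution P w \<longleftrightarrow>
     primal_residual P w = 0 \<and> dual_residual P w = 0 \<and> x_of w \<bullet> s_of w = 0 \<and>
     nonneg_vec (x_of w) \<and> nonneg_vec (s_of w)"

text \<open>\<open>\<gamma>u\<close> and \<open>\<gamma>l\<close> are the upper and lower centrality constants.\<close>

definition nbhd ::
  "('m::finite, 'n::finite) ppm \<Rightarrow> real \<Rightarrow> real \<Rightarrow> real \<Rightarrow> real \<Rightarrow> ('m, 'n) triple set" where
  "nbhd P \<gamma>u \<gamma>l \<gamma>p \<gamma>d =
     {w. pos_vec (x_of w) \<and> pos_vec (s_of w) \<and>
         (\<forall>i. \<gamma>u * mu w \<ge> x_of w $ i * s_of w $ i \<and>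
              x_of w $ i * s_of w $ i \<ge> \<gamma>l * mu w) \<and>
         gap w \<ge> \<gamma>p * norm (primal_residual P w) \<and>
         gap w \<ge> \<gamma>d * norm (dual_residual P w)}"

text \<open>The vector \<open>1\<close> is the all-ones vector.\<close>

definition inexact_newton_direction ::
  "('m::finite, 'n::finite) ppm \<Rightarrow> real \<Rightarrow> real \<Rightarrow> ('m, 'n) triple \<Rightarrow> ('m, 'n) triple \<Rightarrow> bool"
where
  "inexact_newton_direction P \<sigma> C w d \<longleftrightarrow>
     (let X = diag (x_of w); S = diag (s_of w);
          \<xi>d = - dual_residual P w;
          \<xi>p = - primal_residual P w;
          \<xi>\<mu> = - ((S ** X) *v 1 - (\<sigma> * mu w) *\<^sub>R 1)
      in \<exists>\<zeta>. norm \<zeta> \<le> C * gap w \<and>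
             prox_rho P *\<^sub>R x_of d - transpose (Amat P) *v y_of d - s_of d = \<xi>d \<and>
             Amat P *v x_of d + prox_delta P *\<^sub>R y_of d = \<xi>p + \<zeta> \<and>
             S *v x_of d + X *v s_of d = \<xi>\<mu>)"

definition step_to_boundary ::
  "('m::finite, 'n::finite) triple \<Rightarrow> ('m, 'n) triple \<Rightarrow> ereal" where
  "step_to_boundary w d =
     min (SUP \<alpha> \<in> {\<alpha>. nonneg_vec (x_of (w + \<alpha> *\<^sub>R d))}. ereal \<alpha>)
         (SUP \<alpha> \<in> {\<alpha>. nonneg_vec (s_of (w + \<alpha> *\<^sub>R d))}. ereal \<alpha>)"

definition stopping_test ::
  "('m::finite, 'n::finite) ppm \<Rightarrow> ('m, 'n) triple \<Rightarrow> ('m, 'n) triple \<Rightarrow> bool" where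
  "stopping_test P w d \<longleftrightarrow>
     step_to_boundary w d < \<infinity> \<and>
     ppm_solution P (w + real_of_ereal (step_to_boundary w d) *\<^sub>R d)"

definition admissible_steps ::
  "('m::finite, 'n::finite) ppm \<Rightarrow> real \<Rightarrow> real \<Rightarrow> real \<Rightarrow> real \<Rightarrow> real \<Rightarrow>
   ('m, 'n) triple \<Rightarrow> ('m, 'n) triple \<Rightarrow> real set" where
  "admissible_steps P \<gamma>u \<gamma>l \<gamma>p \<gamma>d \<sigma>bar w d =
     {\<alpha> \<in> {0..1}. \<forall>\<alpha>' \<in> {0..\<alpha>}.
        w + \<alpha>' *\<^sub>R d \<in> nbhd P \<gamma>u \<gamma>l \<gamma>p \<gamma>d \<and>
        gap (w + \<alpha>' *\<^sub>R d) \<le> (1 - (1 - \<sigma>bar) * \<alpha>') * gap w}"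

definition is_maximum :: "real set \<Rightarrow> real \<Rightarrow> bool" where
  "is_maximum T \<alpha> \<longleftrightarrow> \<alpha> \<in> T \<and> (\<forall>\<beta> \<in> T. \<beta> \<le> \<alpha>)"

text \<open>
  An infinite run: the stopping test fails at every iteration.  Any inexact Newton direction may
  be chosen at each iteration.
\<close>

definition nonstopping_run ::
  "('m::finite, 'n::finite) ppm \<Rightarrow> real \<Rightarrow> real \<Rightarrow> real \<Rightarrow> real \<Rightarrow> real \<Rightarrow> real \<Rightarrow> real \<Rightarrow>
   (nat \<Rightarrow> ('m, 'n) triple) \<Rightarrow> bool" where
  "nonstopping_run P \<gamma>u \<gamma>l \<gamma>p \<gamma>d \<sigma> \<sigma>bar C w \<longleftrightarrow>
     w 0 \<in> nbhd P \<gamma>u \<gamma>l \<gamma>p \<gamma>d \<and>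
     (\<forall>j. \<exists>d \<alpha>.
        inexact_newton_direction P \<sigma> C (w j) d \<and>
        \<not> stopping_test P (w j) d \<and>
        is_maximum (admissible_steps P \<gamma>u \<gamma>l \<gamma>p \<gamma>d \<sigma>bar (w j) d) \<alpha> \<and>
        w (Suc j) = w j + \<alpha> *\<^sub>R d)"

end

theory Submission
  imports Defs
begin

text \<open>
  The whole argument rests on one identity. If
  \<open>\<rho> u - A\<^sup>T v - t = p\<close> and \<open>A u + \<delta> v = q\<close>, then
  \<open>u \<bullet> t = \<rho> \<parallel>u\<parallel>\<^sup>2 + \<delta> \<parallel>v\<parallel>\<^sup>2 - u \<bullet> p - v \<bullet> q\<close>
  (lemma \<open>kkt_energy\<close>): both regularisation terms make the system coercive, whatever the rank of
  \<open>A\<close>. Consequently, for bounded \<open>p\<close> and \<open>q\<close>, an upper bound on \<open>u \<bullet> t\<close> that grows at most linearly in \<open>\<parallel>u\<parallel>\<close> bounds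
  \<open>u\<close>, \<open>v\<close> and \<open>t\<close> (lemma \<open>kkt_bounded\<close>). The identity is used four times.

  For the homogeneous Newton system \<open>u \<bullet> t \<le> 0\<close>, so that system is injective, and exact Newton
  directions exist. For the difference of two solutions of the proximal problem
  \<open>u \<bullet> t \<le> 0\<close> as well, so the solution is unique. For a point of the neighbourhood
  \<open>u \<bullet> t\<close> is the complementarity gap, so the points whose gap is at most a constant form a bounded
  set. Finally, on the part of that set where the gap is at least \<open>\<epsilon> > 0\<close>, the components of
  \<open>x\<close> and \<open>s\<close> stay away from zero, \<open>u \<bullet> t\<close> grows at most linearly for an
  inexact Newton direction, and these directions are uniformly bounded too.

  Along a direction every defining inequality of the neighbourhood, and the decrease condition, is
  relaxed to first order in the step length \<open>\<alpha>\<close> (this is where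
  \<open>\<gamma>l < 1 < \<gamma>u\<close> and \<open>\<gamma>p C < \<sigma> < \<sigma>bar\<close> enter), and the
  error is quadratic in \<open>\<alpha>\<close>. Hence one step length \<open>\<alpha> > 0\<close> is admissible at all points of the
  neighbourhood whose gap lies in \<open>[\<epsilon>, G]\<close> (lemma \<open>uniform_admissible_step\<close>). A run whose gap stayed
  above \<open>\<epsilon>\<close> would decrease it geometrically, which is absurd; so the gap tends to zero. The iterates
  are bounded, every cluster point is a solution, and the solution is unique, so they converge.

  The largest admissible step exists because the supremum of the admissible steps can fail to
  be admissible only if the limit point leaves the open positive orthant. Its gap then vanishes, it
  solves the problem, and it is the point examined by the stopping test.
\<close>

section \<open>Triples, residuals and Newton directions in components\<close>

lemma of_linear [simp]:
  "x_of (w + v) = x_of w + x_of v" "y_of (w + v) = y_of w + y_of v" "s_of (w + v) = s_of w + s_of v"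
  "x_of (w - v) = x_of w - x_of v" "y_of (w - v) = y_of w - y_of v" "s_of (w - v) = s_of w - s_of v"
  "x_of (a *\<^sub>R w) = a *\<^sub>R x_of w" "y_of (a *\<^sub>R w) = a *\<^sub>R y_of w" "s_of (a *\<^sub>R w) = a *\<^sub>R s_of w"
  by (simp_all add: x_of_def y_of_def s_of_def)

lemma of_zero_iff: "w = 0 \<longleftrightarrow> x_of w = 0 \<and> y_of w = 0 \<and> s_of w = 0"
  by (simp add: x_of_def y_of_def s_of_def prod_eq_iff)

lemma norm_of_le: "norm (x_of w) \<le> norm w" "norm (y_of w) \<le> norm w" "norm (s_of w) \<le> norm w"
  using norm_fst_le[of "fst w" "snd w"] norm_snd_le[of "snd w" "fst w"]
    norm_fst_le[of "fst (snd w)" "snd (snd w)"] norm_snd_le[of "snd (snd w)" "fst (snd w)"]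
  by (simp_all add: x_of_def y_of_def s_of_def)

lemma norm_triple_le: "norm w \<le> norm (x_of w) + norm (y_of w) + norm (s_of w)"
  using norm_Pair_le[of "fst w" "snd w"] norm_Pair_le[of "fst (snd w)" "snd (snd w)"]
  by (simp add: x_of_def y_of_def s_of_def)

lemma tendsto_of:
  assumes "(f \<longlongrightarrow> l) F"
  shows "((\<lambda>a. x_of (f a)) \<longlongrightarrow> x_of l) F" "((\<lambda>a. y_of (f a)) \<longlongrightarrow> y_of l) F"
    "((\<lambda>a. s_of (f a)) \<longlongrightarrow> s_of l) F"
  unfolding x_of_def y_of_def s_of_def by (intro tendsto_intros assms)+

lemma tendsto_gap: "(f \<longlongrightarrow> l) F \<Longrightarrow> ((\<lambda>a. gap (f a)) \<longlongrightarrow> gap l) F"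
  unfolding gap_def by (intro tendsto_intros tendsto_of)

lemma tendsto_mu: "(f \<longlongrightarrow> l) F \<Longrightarrow> ((\<lambda>a. mu (f a)) \<longlongrightarrow> mu l) F"
  unfolding mu_def by (intro tendsto_intros tendsto_gap) simp_all

lemma tendsto_primal_residual:
  "(f \<longlongrightarrow> l) F \<Longrightarrow> ((\<lambda>a. primal_residual P (f a)) \<longlongrightarrow> primal_residual P l) F"
  unfolding primal_residual_def
  by (intro tendsto_intros tendsto_of bounded_linear.tendsto[OF matrix_vector_mul_bounded_linear])

lemma tendsto_dual_residual:
  "(f \<longlongrightarrow> l) F \<Longrightarrow> ((\<lambda>a. dual_residual P (f a)) \<longlongrightarrow> dual_residual P l) F"
  unfolding dual_residual_def
  by (intro tendsto_intros tendsto_of bounded_linear.tendsto[OF matrix_vector_mul_bounded_linear])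

lemma gap_eq_sum: "gap w = (\<Sum>i\<in>UNIV. x_of w $ i * s_of w $ i)"
  by (simp add: gap_def inner_vec_def)

lemma diag_mult_vec: "(diag v *v u) $ i = v $ i * u $ i"
proof -
  have "(\<Sum>j\<in>UNIV. (if i = j then v $ i else 0) * u $ j) = (\<Sum>j\<in>UNIV. if i = j then v $ i * u $ j else 0)"
    by (rule sum.cong) auto
  then show ?thesis
    by (simp add: diag_def matrix_vector_mult_def)
qed

lemma inexact_newton_direction_iff:
  "inexact_newton_direction P \<sigma> C w d \<longleftrightarrow>
   (\<exists>\<zeta>. norm \<zeta> \<le> C * gap w \<and>
        prox_rho P *\<^sub>R x_of d - transpose (Amat P) *v y_of d - s_of d = - dual_residual P w \<and>
        Amat P *v x_of d + prox_delta P *\<^sub>R y_of d = - primal_residual P w + \<zeta> \<and>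
        (\<forall>i. s_of w $ i * x_of d $ i + x_of w $ i * s_of d $ i = \<sigma> * mu w - x_of w $ i * s_of w $ i))"
  by (simp add: inexact_newton_direction_def Let_def vec_eq_iff[of "diag _ *v _ + _"]
      diag_mult_vec matrix_vector_mul_assoc[symmetric] mult.commute)

lemma nbhdD:
  assumes "w \<in> nbhd P \<gamma>u \<gamma>l \<gamma>p \<gamma>d"
  shows "x_of w $ i > 0" "s_of w $ i > 0"
    "x_of w $ i * s_of w $ i \<le> \<gamma>u * mu w" "\<gamma>l * mu w \<le> x_of w $ i * s_of w $ i"
    "\<gamma>p * norm (primal_residual P w) \<le> gap w" "\<gamma>d * norm (dual_residual P w) \<le> gap w"
  using assms by (auto simp: nbhd_def pos_vec_def)

lemma gap_pos:
  assumes "w \<in> nbhd P \<gamma>u \<gamma>l \<gamma>p \<gamma>d"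
  shows "gap w > 0"
  unfolding gap_eq_sum using nbhdD(1,2)[OF assms] by (intro sum_pos) auto

section \<open>Coercivity of the regularised optimality system\<close>

text \<open>The cross terms \<open>u \<bullet> A\<^sup>T v\<close> and \<open>A u \<bullet> v\<close> cancel, so both squares appear with a positive sign.\<close>

lemma kkt_energy:
  fixes A :: "real ^ 'n ^ 'm"
  assumes "\<rho> *\<^sub>R u - transpose A *v v - t = p" and "A *v u + \<delta> *\<^sub>R v = q"
  shows "u \<bullet> t = \<rho> * (norm u)\<^sup>2 + \<delta> * (norm v)\<^sup>2 - u \<bullet> p - v \<bullet> q"
proof -
  have t: "t = \<rho> *\<^sub>R u - transpose A *v v - p" using assms(1) by (auto simp: algebra_simps)
  have "u \<bullet> (transpose A *v v) = (A *v u) \<bullet> v"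
    by (metis dot_lmul_matrix vector_transpose_matrix)
  also have "\<dots> = v \<bullet> q - \<delta> * (norm v)\<^sup>2"
    by (simp add: assms(2)[symmetric] inner_add_left inner_add_right inner_commute power2_norm_eq_inner)
  finally show ?thesis
    by (simp add: t inner_diff_right power2_norm_eq_inner)
qed

lemma kkt_zero:
  fixes A :: "real ^ 'n ^ 'm"
  assumes "\<rho> > 0" "\<delta> > 0"
    and "\<rho> *\<^sub>R u - transpose A *v v - t = 0" and "A *v u + \<delta> *\<^sub>R v = 0" and "u \<bullet> t \<le> 0"
  shows "u = 0 \<and> v = 0 \<and> t = 0"
proof -
  have "\<rho> * (norm u)\<^sup>2 + \<delta> * (norm v)\<^sup>2 \<le> 0"
    using kkt_energy[OF assms(3,4)] assms(5) by simp
  moreover have "\<rho> * (norm u)\<^sup>2 \<ge> 0" "\<delta> * (norm v)\<^sup>2 \<ge> 0" using assms by simp_all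
  ultimately have "\<rho> * (norm u)\<^sup>2 = 0" "\<delta> * (norm v)\<^sup>2 = 0" by linarith+
  then have "u = 0" "v = 0" using assms by simp_all
  then show ?thesis using assms(3) by simp
qed

text \<open>
  Applied to iterates, \<open>u \<bullet> t\<close> is the gap; for Newton directions only the linear growth allowed
  here is available.
\<close>

lemma kkt_bounded:
  fixes A :: "real ^ 'n ^ 'm"
  assumes "\<rho> > 0" "\<delta> > 0"
  obtains K where "\<And>u v t. norm (\<rho> *\<^sub>R u - transpose A *v v - t) \<le> B \<Longrightarrow>
      norm (A *v u + \<delta> *\<^sub>R v) \<le> B \<Longrightarrow> u \<bullet> t \<le> B * (1 + norm u) \<Longrightarrow>
      norm u + norm v + norm t \<le> K"
proof -
  define \<kappa> where "\<kappa> = min \<rho> \<delta>"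
  define M where "M = onorm (\<lambda>v. transpose A *v v)"
  define R where "R = 1 + 8 * B / \<kappa>"
  have k: "\<kappa> > 0" "\<kappa> \<le> \<rho>" "\<kappa> \<le> \<delta>" using assms by (auto simp: \<kappa>_def)
  have M: "norm (transpose A *v v) \<le> M * norm v" "M \<ge> 0" for v
    unfolding M_def
    by (rule onorm[OF matrix_vector_mul_bounded_linear]
        onorm_pos_le[OF matrix_vector_mul_bounded_linear])+
  have "norm u + norm v + norm t \<le> R + \<rho> * R + M * R + B"
    if 1: "norm (\<rho> *\<^sub>R u - transpose A *v v - t) \<le> B" and 2: "norm (A *v u + \<delta> *\<^sub>R v) \<le> B"
      and 3: "u \<bullet> t \<le> B * (1 + norm u)" for u v t
  proof -
    define p where "p = \<rho> *\<^sub>R u - transpose A *v v - t"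
    define q where "q = A *v u + \<delta> *\<^sub>R v"
    define r where "r = norm u + norm v"
    have B: "B \<ge> 0" using norm_ge_zero 1 by (rule order_trans)
    have r: "norm u \<le> r" "norm v \<le> r" by (simp_all add: r_def)
    have e: "\<rho> * (norm u)\<^sup>2 + \<delta> * (norm v)\<^sup>2 = u \<bullet> t + u \<bullet> p + v \<bullet> q"
      using kkt_energy[OF p_def[symmetric] q_def[symmetric]] by simp
    have "u \<bullet> p \<le> norm u * B" "v \<bullet> q \<le> norm v * B"
      using 1 2 unfolding p_def[symmetric] q_def[symmetric]
      by (auto intro!: order_trans[OF norm_cauchy_schwarz] mult_left_mono)
    then have "\<rho> * (norm u)\<^sup>2 + \<delta> * (norm v)\<^sup>2 \<le> B * (1 + norm u) + norm u * B + norm v * B"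
      using e 3 by linarith
    also have "\<dots> = B + 2 * (B * norm u) + B * norm v" by (simp add: algebra_simps)
    also have "\<dots> \<le> B + 3 * (B * r)"
      using mult_left_mono[OF r(1) B] mult_left_mono[OF r(2) B] by linarith
    finally have e1: "\<rho> * (norm u)\<^sup>2 + \<delta> * (norm v)\<^sup>2 \<le> B + 3 * (B * r)" .
    have "r\<^sup>2 \<le> 2 * ((norm u)\<^sup>2 + (norm v)\<^sup>2)"
      using sum_squares_bound[of "norm u" "norm v"] by (simp add: r_def power2_sum)
    then have "\<kappa> * r\<^sup>2 \<le> 2 * (\<kappa> * (norm u)\<^sup>2 + \<kappa> * (norm v)\<^sup>2)"
      using mult_left_mono[OF _ less_imp_le[OF k(1)]] by (fastforce simp: algebra_simps)
    also have "\<dots> \<le> 2 * (\<rho> * (norm u)\<^sup>2 + \<delta> * (norm v)\<^sup>2)"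
      using k by (intro mult_left_mono add_mono mult_right_mono) auto
    also have "\<dots> \<le> 2 * (B + 3 * (B * r))"
      using e1 by (intro mult_left_mono) auto
    finally have e2: "\<kappa> * r\<^sup>2 \<le> 2 * B + 6 * (B * r)" by (simp add: algebra_simps)
    have rR: "r \<le> R"
    proof (cases "r \<le> 1")
      case True
      moreover have "8 * B / \<kappa> \<ge> 0" using B k by simp
      ultimately show ?thesis by (simp add: R_def)
    next
      case False
      then have "B \<le> B * r" using B by (simp add: mult_le_cancel_left1)
      then have "\<kappa> * r\<^sup>2 \<le> 8 * (B * r)" using e2 by linarith
      then have "\<kappa> * r * r \<le> 8 * B * r" by (simp add: power2_eq_square mult.assoc)
      then have "\<kappa> * r \<le> 8 * B" using False by simp
      then have "r \<le> 8 * B / \<kappa>" using k by (simp add: field_simps)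
      then show ?thesis by (simp add: R_def)
    qed
    have "t = \<rho> *\<^sub>R u - transpose A *v v - p" by (simp add: p_def)
    then have "norm t \<le> norm (\<rho> *\<^sub>R u) + norm (transpose A *v v) + norm p"
      by (metis (no_types, opaque_lifting) norm_triangle_ineq4 order_trans add_right_mono)
    also have "\<dots> \<le> \<rho> * R + M * R + B"
    proof (intro add_mono)
      show "norm (\<rho> *\<^sub>R u) \<le> \<rho> * R" using assms r rR by (auto intro!: mult_left_mono)
      show "norm (transpose A *v v) \<le> M * R"
        using order_trans[OF M(1) mult_left_mono[OF order_trans[OF r(2) rR] M(2)]] .
      show "norm p \<le> B" using 1 by (simp add: p_def)
    qed
    finally show ?thesis using rR by (simp add: r_def)
  qed
  then show thesis by (rule that)
qed

section \<open>Uniqueness of the solution and existence of Newton directions\<close>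

lemma ppm_solution_unique:
  assumes "prox_rho P > 0" "prox_delta P > 0" and v: "ppm_solution P v" and w: "ppm_solution P w"
  shows "v = w"
proof -
  have 1: "prox_rho P *\<^sub>R (x_of v - x_of w) - transpose (Amat P) *v (y_of v - y_of w) - (s_of v - s_of w) = 0"
  proof -
    have "dual_residual P v - dual_residual P w = 0" using v w by (simp add: ppm_solution_def)
    then show ?thesis
      by (simp add: dual_residual_def algebra_simps matrix_vector_mult_diff_distrib)
  qed
  have 2: "Amat P *v (x_of v - x_of w) + prox_delta P *\<^sub>R (y_of v - y_of w) = 0"
  proof -
    have "primal_residual P v - primal_residual P w = 0" using v w by (simp add: ppm_solution_def)
    then show ?thesis
      by (simp add: primal_residual_def algebra_simps matrix_vector_mult_diff_distrib)
  qed
  have nn: "x_of v \<bullet> s_of w \<ge> 0" "x_of w \<bullet> s_of v \<ge> 0"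
    using v w by (auto simp: ppm_solution_def nonneg_vec_def inner_vec_def intro!: sum_nonneg)
  have "(x_of v - x_of w) \<bullet> (s_of v - s_of w) \<le> 0"
    using v w nn by (simp add: ppm_solution_def inner_diff_left inner_diff_right)
  from kkt_zero[OF assms(1,2) 1 2 this] have "v - w = 0" by (simp add: of_zero_iff)
  then show ?thesis by simp
qed

text \<open>The exact Newton system is square, so it suffices that it is injective.\<close>

lemma newton_direction_exists:
  fixes P :: "('m::finite, 'n::finite) ppm"
  assumes "prox_rho P > 0" "prox_delta P > 0" "C > 0" and w: "w \<in> nbhd P \<gamma>u \<gamma>l \<gamma>p \<gamma>d"
  shows "\<exists>d. inexact_newton_direction P \<sigma> C w d"
proof -
  define L :: "('m, 'n) triple \<Rightarrow> ('m, 'n) triple" where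
    "L d = (prox_rho P *\<^sub>R x_of d - transpose (Amat P) *v y_of d - s_of d,
            Amat P *v x_of d + prox_delta P *\<^sub>R y_of d,
            \<chi> i. s_of w $ i * x_of d $ i + x_of w $ i * s_of d $ i)" for d
  have lin: "linear L"
    by (rule linearI) (auto simp: L_def vec_eq_iff matrix_vector_right_distrib
        matrix_vector_mult_scaleR algebra_simps)
  have "inj L"
    unfolding linear_injective_0[OF lin]
  proof (intro allI impI)
    fix d assume "L d = 0"
    then have 1: "prox_rho P *\<^sub>R x_of d - transpose (Amat P) *v y_of d - s_of d = 0"
      and 2: "Amat P *v x_of d + prox_delta P *\<^sub>R y_of d = 0"
      and 3: "s_of w $ i * x_of d $ i + x_of w $ i * s_of d $ i = 0" for i
      by (auto simp: L_def zero_prod_def vec_eq_iff)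
    have "x_of d $ i * s_of d $ i \<le> 0" for i
    proof -
      have "x_of w $ i * (x_of d $ i * s_of d $ i) = - (s_of w $ i * (x_of d $ i)\<^sup>2)"
        using 3[of i] by (simp add: power2_eq_square) algebra
      also have "\<dots> \<le> 0" using nbhdD(2)[OF w, of i] by simp
      finally show ?thesis using nbhdD(1)[OF w, of i] by (simp add: mult_le_0_iff)
    qed
    then have "x_of d \<bullet> s_of d \<le> 0" by (auto simp: inner_vec_def intro!: sum_nonpos)
    from kkt_zero[OF assms(1,2) 1 2 this] show "d = 0" by (simp add: of_zero_iff)
  qed
  with lin have "surj L" by (intro linear_injective_imp_surjective) simp_all
  then obtain d where d: "(- dual_residual P w, - primal_residual P w,
      \<chi> i. \<sigma> * mu w - x_of w $ i * s_of w $ i) = L d"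
    by (rule surjE)
  have "norm (0 :: real ^ 'm) \<le> C * gap w" using assms(3) gap_pos[OF w] by simp
  then show ?thesis
    using d unfolding inexact_newton_direction_iff L_def
    by (intro exI[of _ d] exI[of _ 0]) (auto simp: vec_eq_iff[of "\<chi> i. _ i"])
qed

section \<open>Uniform bounds on iterates and directions\<close>

lemma nbhd_bounded:
  fixes P :: "('m::finite, 'n::finite) ppm"
  assumes "prox_rho P > 0" "prox_delta P > 0" "\<gamma>p > 0" "\<gamma>d > 0"
  obtains K where "\<And>w. w \<in> nbhd P \<gamma>u \<gamma>l \<gamma>p \<gamma>d \<Longrightarrow> gap w \<le> G \<Longrightarrow> norm w \<le> K"
proof -
  define p0 where "p0 = prox_rho P *\<^sub>R x_ref P - cost P"
  define q0 where "q0 = prox_delta P *\<^sub>R y_ref P + rhs P"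
  define B where "B = \<bar>G\<bar> / \<gamma>d + \<bar>G\<bar> / \<gamma>p + \<bar>G\<bar> + norm p0 + norm q0"
  obtain K where K: "\<And>u v t. norm (prox_rho P *\<^sub>R u - transpose (Amat P) *v v - t) \<le> B \<Longrightarrow>
      norm (Amat P *v u + prox_delta P *\<^sub>R v) \<le> B \<Longrightarrow> u \<bullet> t \<le> B * (1 + norm u) \<Longrightarrow>
      norm u + norm v + norm t \<le> K"
    using kkt_bounded[OF assms(1,2), of "Amat P" B] by blast
  have "norm w \<le> K" if w: "w \<in> nbhd P \<gamma>u \<gamma>l \<gamma>p \<gamma>d" and G: "gap w \<le> G" for w
  proof -
    have pos: "\<bar>G\<bar> / \<gamma>d \<ge> 0" "\<bar>G\<bar> / \<gamma>p \<ge> 0" using assms by auto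
    have "norm (dual_residual P w) \<le> \<bar>G\<bar> / \<gamma>d" "norm (primal_residual P w) \<le> \<bar>G\<bar> / \<gamma>p"
      using nbhdD(5,6)[OF w] G assms by (auto simp: field_simps)
    moreover have
      eqs: "prox_rho P *\<^sub>R x_of w - transpose (Amat P) *v y_of w - s_of w = dual_residual P w + p0"
      "Amat P *v x_of w + prox_delta P *\<^sub>R y_of w = primal_residual P w + q0"
      by (simp_all add: dual_residual_def primal_residual_def p0_def q0_def algebra_simps)
    moreover have "norm (dual_residual P w + p0) \<le> norm (dual_residual P w) + norm p0"
      "norm (primal_residual P w + q0) \<le> norm (primal_residual P w) + norm q0"
      by (rule norm_triangle_ineq)+
    moreover note pos norm_ge_zero[of p0] norm_ge_zero[of q0] abs_ge_zero[of G] B_def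
    ultimately have "norm (prox_rho P *\<^sub>R x_of w - transpose (Amat P) *v y_of w - s_of w) \<le> B"
      and "norm (Amat P *v x_of w + prox_delta P *\<^sub>R y_of w) \<le> B"
      unfolding eqs by linarith+
    moreover have "x_of w \<bullet> s_of w \<le> B * (1 + norm (x_of w))"
    proof -
      have "G \<le> B" using pos norm_ge_zero[of p0] norm_ge_zero[of q0] unfolding B_def by linarith
      moreover have "0 \<le> B * norm (x_of w)" using pos by (simp add: B_def)
      ultimately show ?thesis using G by (simp add: gap_def algebra_simps)
    qed
    ultimately show ?thesis using K norm_triple_le order_trans by blast
  qed
  then show thesis by (rule that)
qed

lemma nbhd_components_bounded_below:
  fixes P :: "('m::finite, 'n::finite) ppm"
  assumes "\<epsilon> > 0" "\<gamma>l > 0"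
  obtains l where "l > 0" "\<And>w i. w \<in> nbhd P \<gamma>u \<gamma>l \<gamma>p \<gamma>d \<Longrightarrow> \<epsilon> \<le> gap w \<Longrightarrow> norm w \<le> K \<Longrightarrow>
      l \<le> x_of w $ i \<and> l \<le> s_of w $ i"
proof -
  define c where "c = \<gamma>l * (\<epsilon> / real CARD('n))"
  have c: "c > 0" using assms by (simp add: c_def)
  have *: "c / (1 + \<bar>K\<bar>) \<le> x_of w $ i \<and> c / (1 + \<bar>K\<bar>) \<le> s_of w $ i"
    if w: "w \<in> nbhd P \<gamma>u \<gamma>l \<gamma>p \<gamma>d" and e: "\<epsilon> \<le> gap w" and K: "norm w \<le> K" for w i
  proof -
    have "c \<le> \<gamma>l * mu w" unfolding c_def mu_def using assms e
      by (intro mult_left_mono divide_right_mono) auto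
    also have "\<dots> \<le> x_of w $ i * s_of w $ i" by (rule nbhdD(4)[OF w])
    finally have cxs: "c \<le> x_of w $ i * s_of w $ i" .
    have "\<bar>x_of w $ i\<bar> \<le> K" "\<bar>s_of w $ i\<bar> \<le> K"
      using component_le_norm_cart[of "x_of w" i] component_le_norm_cart[of "s_of w" i]
        norm_of_le[of w] K by linarith+
    then have b: "x_of w $ i \<le> 1 + \<bar>K\<bar>" "s_of w $ i \<le> 1 + \<bar>K\<bar>" by linarith+
    have "c \<le> x_of w $ i * (1 + \<bar>K\<bar>)"
      using cxs mult_left_mono[OF b(2), of "x_of w $ i"] nbhdD(1)[OF w, of i] by linarith
    moreover have "c \<le> s_of w $ i * (1 + \<bar>K\<bar>)"
      using cxs mult_left_mono[OF b(1), of "s_of w $ i"] nbhdD(2)[OF w, of i]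
      by (simp only: mult.commute[of "x_of w $ i"]) linarith
    moreover have "1 + \<bar>K\<bar> > 0" by linarith
    ultimately show ?thesis by (simp add: pos_divide_le_eq)
  qed
  have "c / (1 + \<bar>K\<bar>) > 0" using c by (simp add: divide_pos_pos add_pos_nonneg)
  then show thesis using * by (rule that)
qed

text \<open>
  By the third Newton equation, \<open>x\<^sub>i \<Delta>x\<^sub>i \<Delta>s\<^sub>i = r\<^sub>i \<Delta>x\<^sub>i - s\<^sub>i \<Delta>x\<^sub>i\<^sup>2 \<le> r\<^sub>i \<Delta>x\<^sub>i\<close> with a bounded \<open>r\<^sub>i\<close>,
  so \<open>\<Delta>x \<bullet> \<Delta>s\<close> grows at most linearly in \<open>\<parallel>\<Delta>x\<parallel>\<close>.
\<close>

lemma direction_bounded: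
  fixes P :: "('m::finite, 'n::finite) ppm"
  assumes "prox_rho P > 0" "prox_delta P > 0" "\<gamma>p > 0" "\<gamma>d > 0" "\<sigma> > 0" "C > 0" "l > 0"
  obtains K where "\<And>w d. w \<in> nbhd P \<gamma>u \<gamma>l \<gamma>p \<gamma>d \<Longrightarrow> gap w \<le> G \<Longrightarrow> (\<And>i. l \<le> x_of w $ i) \<Longrightarrow>
      inexact_newton_direction P \<sigma> C w d \<Longrightarrow> norm d \<le> K"
proof -
  define E where "E = real CARD('n) * ((\<sigma> + 1) * \<bar>G\<bar> / l)"
  define B where "B = \<bar>G\<bar> / \<gamma>d + \<bar>G\<bar> / \<gamma>p + C * \<bar>G\<bar> + E"
  obtain K where K: "\<And>u v t. norm (prox_rho P *\<^sub>R u - transpose (Amat P) *v v - t) \<le> B \<Longrightarrow>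
      norm (Amat P *v u + prox_delta P *\<^sub>R v) \<le> B \<Longrightarrow> u \<bullet> t \<le> B * (1 + norm u) \<Longrightarrow>
      norm u + norm v + norm t \<le> K"
    using kkt_bounded[OF assms(1,2), of "Amat P" B] by blast
  have "norm d \<le> K" if w: "w \<in> nbhd P \<gamma>u \<gamma>l \<gamma>p \<gamma>d" and G: "gap w \<le> G"
    and l: "\<And>i. l \<le> x_of w $ i" and "inexact_newton_direction P \<sigma> C w d" for w d
  proof -
    from that(4) obtain \<zeta> where z: "norm \<zeta> \<le> C * gap w"
      and 1: "prox_rho P *\<^sub>R x_of d - transpose (Amat P) *v y_of d - s_of d = - dual_residual P w"
      and 2: "Amat P *v x_of d + prox_delta P *\<^sub>R y_of d = - primal_residual P w + \<zeta>"
      and 3: "\<And>i. s_of w $ i * x_of d $ i + x_of w $ i * s_of d $ i = \<sigma> * mu w - x_of w $ i * s_of w $ i"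
      by (auto simp: inexact_newton_direction_iff)
    have G0: "G > 0" using gap_pos[OF w] G by linarith
    have pos: "\<bar>G\<bar> / \<gamma>d \<ge> 0" "\<bar>G\<bar> / \<gamma>p \<ge> 0" "C * \<bar>G\<bar> \<ge> 0" "E \<ge> 0"
      using assms by (auto simp: E_def)
    have "norm (dual_residual P w) \<le> \<bar>G\<bar> / \<gamma>d" "norm (primal_residual P w) \<le> \<bar>G\<bar> / \<gamma>p"
      using nbhdD(5,6)[OF w] G assms by (auto simp: field_simps)
    moreover have "norm \<zeta> \<le> C * \<bar>G\<bar>"
      using z mult_left_mono[of "gap w" "\<bar>G\<bar>" C] G assms by linarith
    ultimately have a: "norm (prox_rho P *\<^sub>R x_of d - transpose (Amat P) *v y_of d - s_of d) \<le> B"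
      "norm (Amat P *v x_of d + prox_delta P *\<^sub>R y_of d) \<le> B"
      unfolding 1 2 using norm_triangle_ineq[of "- primal_residual P w" \<zeta>] pos
      by (simp_all add: B_def)
    have "x_of d $ i * s_of d $ i \<le> (\<sigma> + 1) * \<bar>G\<bar> / l * norm (x_of d)" for i
    proof -
      define r where "r = \<sigma> * mu w - x_of w $ i * s_of w $ i"
      have x: "x_of w $ i > 0" "s_of w $ i > 0" using nbhdD(1,2)[OF w] by auto
      have "x_of w $ i * s_of w $ i \<le> gap w" unfolding gap_eq_sum
        using nbhdD(1,2)[OF w] by (intro member_le_sum) (auto intro: less_imp_le)
      moreover have "mu w \<le> gap w" "0 \<le> mu w"
        using gap_pos[OF w] by (auto simp: mu_def divide_le_eq mult_le_cancel_left1)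
      then have "\<sigma> * mu w \<le> \<sigma> * gap w" "\<sigma> * mu w \<ge> 0" using assms by auto
      moreover have "x_of w $ i * s_of w $ i > 0" using x by simp
      moreover have "\<sigma> * gap w \<le> \<sigma> * G" "\<sigma> * G > 0" using G G0 assms by auto
      ultimately have "\<bar>r\<bar> \<le> (\<sigma> + 1) * \<bar>G\<bar>"
        using G G0 by (simp add: r_def algebra_simps)
      moreover have "\<bar>x_of d $ i\<bar> \<le> norm (x_of d)" by (rule component_le_norm_cart)
      ultimately have *: "\<bar>r\<bar> * \<bar>x_of d $ i\<bar> \<le> (\<sigma> + 1) * \<bar>G\<bar> * norm (x_of d)"
        by (intro mult_mono) auto
      have "x_of w $ i * (x_of d $ i * s_of d $ i) = r * x_of d $ i - s_of w $ i * (x_of d $ i)\<^sup>2"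
        unfolding r_def 3[of i, symmetric] by (simp add: algebra_simps power2_eq_square)
      also have "\<dots> \<le> r * x_of d $ i" using x by simp
      also have "\<dots> \<le> \<bar>r\<bar> * \<bar>x_of d $ i\<bar>" by (metis abs_ge_self abs_mult)
      also have "\<dots> \<le> (\<sigma> + 1) * \<bar>G\<bar> * norm (x_of d)" by (rule *)
      finally have "x_of d $ i * s_of d $ i \<le> (\<sigma> + 1) * \<bar>G\<bar> * norm (x_of d) / x_of w $ i"
        using x by (simp add: field_simps)
      also have "\<dots> \<le> (\<sigma> + 1) * \<bar>G\<bar> * norm (x_of d) / l"
        using l[of i] x assms by (intro divide_left_mono) auto
      finally show ?thesis by simp
    qed
    then have "x_of d \<bullet> s_of d \<le> E * norm (x_of d)"
      unfolding inner_vec_def E_def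
      by (intro order_trans[OF sum_bounded_above[of UNIV]]) auto
    also have "\<dots> \<le> B * (1 + norm (x_of d))"
      using pos by (intro mult_mono) (auto simp: B_def)
    finally show ?thesis using K[OF a] norm_triple_le[of d] by linarith
  qed
  then show thesis by (rule that)
qed

section \<open>A uniform admissible step\<close>

text \<open>A quadratic error term is absorbed by a linear gain once the step is short enough.\<close>

lemma quadratic_error:
  fixes a :: real
  assumes "0 \<le> a" "\<bar>c\<bar> \<le> k" "a * k \<le> b"
  shows "\<bar>a\<^sup>2 * c\<bar> \<le> a * b"
proof -
  have "a * (a * \<bar>c\<bar>) \<le> a * (a * k)" using assms by (intro mult_left_mono) auto
  also have "\<dots> \<le> a * b" using assms by (intro mult_left_mono) auto
  finally show ?thesis by (simp add: abs_mult power2_eq_square mult.assoc)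
qed

text \<open>
  Along a direction the linearised part of \<open>x\<^sub>i s\<^sub>i\<close> moves towards the target \<open>\<sigma> \<mu>\<close>, common to
  all \<open>i\<close>; this is what relaxes the centrality bounds.
\<close>

lemma product_along_direction:
  assumes "inexact_newton_direction P \<sigma> C w d"
  shows "x_of (w + a *\<^sub>R d) $ i * s_of (w + a *\<^sub>R d) $ i =
    (1 - a) * (x_of w $ i * s_of w $ i) + a * \<sigma> * mu w + a\<^sup>2 * (x_of d $ i * s_of d $ i)"
proof -
  have 3: "s_of w $ i * x_of d $ i + x_of w $ i * s_of d $ i = \<sigma> * mu w - x_of w $ i * s_of w $ i"
    using assms by (auto simp: inexact_newton_direction_iff)
  have "x_of (w + a *\<^sub>R d) $ i * s_of (w + a *\<^sub>R d) $ i = x_of w $ i * s_of w $ i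
    + a * (s_of w $ i * x_of d $ i + x_of w $ i * s_of d $ i) + a\<^sup>2 * (x_of d $ i * s_of d $ i)"
    by (simp add: algebra_simps power2_eq_square)
  then show ?thesis unfolding 3 by (simp add: algebra_simps)
qed

lemma gap_along_direction:
  fixes w :: "('m::finite, 'n::finite) triple"
  assumes "inexact_newton_direction P \<sigma> C w d"
  shows "gap (w + a *\<^sub>R d) = (1 - a) * gap w + a * \<sigma> * gap w + a\<^sup>2 * (x_of d \<bullet> s_of d)"
proof -
  have "gap (w + a *\<^sub>R d) =
    (1 - a) * gap w + real CARD('n) * (a * \<sigma> * mu w) + a\<^sup>2 * (x_of d \<bullet> s_of d)"
    unfolding gap_eq_sum product_along_direction[OF assms]
    by (simp add: sum.distrib sum_distrib_left[symmetric] inner_vec_def)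
  then show ?thesis by (simp add: mu_def)
qed

lemma residuals_along_direction:
  assumes "inexact_newton_direction P \<sigma> C w d" and "0 \<le> a" "a \<le> 1"
  shows "norm (dual_residual P (w + a *\<^sub>R d)) = (1 - a) * norm (dual_residual P w)"
    and "norm (primal_residual P (w + a *\<^sub>R d)) \<le> (1 - a) * norm (primal_residual P w) + a * (C * gap w)"
proof -
  from assms(1) obtain \<zeta> where z: "norm \<zeta> \<le> C * gap w"
    and 1: "prox_rho P *\<^sub>R x_of d - transpose (Amat P) *v y_of d - s_of d = - dual_residual P w"
    and 2: "Amat P *v x_of d + prox_delta P *\<^sub>R y_of d = - primal_residual P w + \<zeta>"
    by (auto simp: inexact_newton_direction_iff)
  have "dual_residual P (w + a *\<^sub>R d) =
      dual_residual P w + a *\<^sub>R (prox_rho P *\<^sub>R x_of d - transpose (Amat P) *v y_of d - s_of d)"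
    by (simp add: dual_residual_def algebra_simps)
  also have "\<dots> = (1 - a) *\<^sub>R dual_residual P w" unfolding 1 by (simp add: algebra_simps)
  finally show "norm (dual_residual P (w + a *\<^sub>R d)) = (1 - a) * norm (dual_residual P w)"
    using assms by simp
  have "primal_residual P (w + a *\<^sub>R d) =
      primal_residual P w + a *\<^sub>R (Amat P *v x_of d + prox_delta P *\<^sub>R y_of d)"
    by (simp add: primal_residual_def algebra_simps)
  also have "\<dots> = (1 - a) *\<^sub>R primal_residual P w + a *\<^sub>R \<zeta>" unfolding 2 by (simp add: algebra_simps)
  finally have "norm (primal_residual P (w + a *\<^sub>R d)) \<le>
      norm ((1 - a) *\<^sub>R primal_residual P w) + norm (a *\<^sub>R \<zeta>)"
    by (simp only: norm_triangle_ineq)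
  also have "\<dots> \<le> (1 - a) * norm (primal_residual P w) + a * (C * gap w)"
    using assms z by (auto intro!: mult_left_mono)
  finally show "norm (primal_residual P (w + a *\<^sub>R d)) \<le> \<dots>" .
qed

text \<open>
  The hypotheses bound the step in terms of a bound \<open>K\<close> on the direction, a lower bound \<open>\<epsilon>\<close> on
  the gap and a lower bound \<open>l\<close> on the components of \<open>x\<close> and \<open>s\<close>; they are monotone in the step.
\<close>

lemma short_step:
  fixes P :: "('m::finite, 'n::finite) ppm"
  assumes w: "w \<in> nbhd P \<gamma>u \<gamma>l \<gamma>p \<gamma>d" and d: "inexact_newton_direction P \<sigma> C w d"
    and par: "0 < \<gamma>l" "\<gamma>l < 1" "1 < \<gamma>u" "\<gamma>p > 0" "\<gamma>d > 0" "0 < \<sigma>" "\<sigma> < \<sigma>bar" "0 < C" "\<gamma>p * C < \<sigma>"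
    and K: "norm d \<le> K" and e: "\<epsilon> \<le> gap w" and l: "\<And>i. l \<le> x_of w $ i \<and> l \<le> s_of w $ i"
    and a: "0 \<le> a" "a \<le> 1" "a * K < l"
    and c1: "a * ((1 + \<gamma>l) * K\<^sup>2) \<le> \<sigma> * (1 - \<gamma>l) * (\<epsilon> / real CARD('n))"
    and c2: "a * ((1 + \<gamma>u) * K\<^sup>2) \<le> \<sigma> * (\<gamma>u - 1) * (\<epsilon> / real CARD('n))"
    and c3: "a * K\<^sup>2 \<le> (\<sigma> - \<gamma>p * C) * \<epsilon>"
    and c4: "a * K\<^sup>2 \<le> (\<sigma>bar - \<sigma>) * \<epsilon>"
  shows "w + a *\<^sub>R d \<in> nbhd P \<gamma>u \<gamma>l \<gamma>p \<gamma>d" (is "?w \<in> _")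
    and "gap (w + a *\<^sub>R d) \<le> (1 - (1 - \<sigma>bar) * a) * gap w"
proof -
  define D where "D = x_of d \<bullet> s_of d"
  have K0: "K \<ge> 0" using norm_ge_zero K by (rule order_trans)
  have nx: "norm (x_of d) \<le> K" "norm (s_of d) \<le> K" using norm_of_le[of d] K by linarith+
  have cx: "\<bar>x_of d $ i\<bar> \<le> K" "\<bar>s_of d $ i\<bar> \<le> K" for i
    using component_le_norm_cart order_trans nx by blast+
  have cc: "\<bar>x_of d $ i * s_of d $ i\<bar> \<le> K\<^sup>2" for i
    unfolding abs_mult power2_eq_square using cx K0 by (intro mult_mono) auto
  have D: "\<bar>D\<bar> \<le> K\<^sup>2" unfolding D_def power2_eq_square
    using nx K0 by (intro order_trans[OF Cauchy_Schwarz_ineq2] mult_mono) auto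
  have Dn: "\<bar>D / real CARD('n)\<bar> \<le> K\<^sup>2"
  proof -
    have "\<bar>D / real CARD('n)\<bar> \<le> \<bar>D\<bar>" by (simp add: abs_divide divide_le_eq mult_le_cancel_left1)
    then show ?thesis using D by linarith
  qed
  have m: "\<epsilon> / real CARD('n) \<le> mu w" unfolding mu_def using e by (intro divide_right_mono) auto
  have gap': "gap ?w = (1 - a) * gap w + a * \<sigma> * gap w + a\<^sup>2 * D"
    unfolding D_def by (rule gap_along_direction[OF d])
  have mu': "mu ?w = (1 - a) * mu w + a * \<sigma> * mu w + a\<^sup>2 * (D / real CARD('n))"
    unfolding mu_def gap' by (simp add: add_divide_distrib)

  have "\<bar>a\<^sup>2 * D\<bar> \<le> a * ((\<sigma>bar - \<sigma>) * gap w)"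
    using c4 mult_left_mono[OF e, of "\<sigma>bar - \<sigma>"] par
    by (intro quadratic_error[OF a(1) D]) linarith
  then show "gap ?w \<le> (1 - (1 - \<sigma>bar) * a) * gap w"
    unfolding gap' by (simp add: algebra_simps)

  have "x_of ?w $ i > 0 \<and> s_of ?w $ i > 0" for i
  proof -
    have "\<bar>a * x_of d $ i\<bar> \<le> a * K" "\<bar>a * s_of d $ i\<bar> \<le> a * K"
      using a cx by (auto simp: abs_mult intro: mult_left_mono)
    then show ?thesis using l[of i] a(3) by (simp, linarith)
  qed
  moreover have "\<gamma>l * mu ?w \<le> x_of ?w $ i * s_of ?w $ i" for i
  proof -
    define E where "E = x_of d $ i * s_of d $ i - \<gamma>l * (D / real CARD('n))"
    have "\<bar>\<gamma>l * (D / real CARD('n))\<bar> \<le> \<gamma>l * K\<^sup>2"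
      using mult_left_mono[OF Dn, of \<gamma>l] par by (simp add: abs_mult)
    then have "\<bar>E\<bar> \<le> (1 + \<gamma>l) * K\<^sup>2" using cc[of i] unfolding E_def distrib_right by linarith
    moreover have "a * ((1 + \<gamma>l) * K\<^sup>2) \<le> \<sigma> * (1 - \<gamma>l) * mu w"
      using c1 mult_left_mono[OF m, of "\<sigma> * (1 - \<gamma>l)"] par by simp
    ultimately have "\<bar>a\<^sup>2 * E\<bar> \<le> a * (\<sigma> * (1 - \<gamma>l) * mu w)" using quadratic_error a(1) by blast
    moreover have "0 \<le> (1 - a) * (x_of w $ i * s_of w $ i - \<gamma>l * mu w)"
      using a nbhdD(4)[OF w, of i] by simp
    moreover have "x_of ?w $ i * s_of ?w $ i - \<gamma>l * mu ?w =
      (1 - a) * (x_of w $ i * s_of w $ i - \<gamma>l * mu w) + a * (\<sigma> * (1 - \<gamma>l) * mu w) + a\<^sup>2 * E"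
      unfolding product_along_direction[OF d] mu' E_def by (simp add: algebra_simps)
    ultimately show ?thesis by linarith
  qed
  moreover have "x_of ?w $ i * s_of ?w $ i \<le> \<gamma>u * mu ?w" for i
  proof -
    define E where "E = \<gamma>u * (D / real CARD('n)) - x_of d $ i * s_of d $ i"
    have "\<bar>\<gamma>u * (D / real CARD('n))\<bar> \<le> \<gamma>u * K\<^sup>2"
      using mult_left_mono[OF Dn, of \<gamma>u] par by (simp add: abs_mult)
    then have "\<bar>E\<bar> \<le> (1 + \<gamma>u) * K\<^sup>2" using cc[of i] unfolding E_def distrib_right by linarith
    moreover have "a * ((1 + \<gamma>u) * K\<^sup>2) \<le> \<sigma> * (\<gamma>u - 1) * mu w"
      using c2 mult_left_mono[OF m, of "\<sigma> * (\<gamma>u - 1)"] par by simp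
    ultimately have "\<bar>a\<^sup>2 * E\<bar> \<le> a * (\<sigma> * (\<gamma>u - 1) * mu w)" using quadratic_error a(1) by blast
    moreover have "0 \<le> (1 - a) * (\<gamma>u * mu w - x_of w $ i * s_of w $ i)"
      using a nbhdD(3)[OF w, of i] by simp
    moreover have "\<gamma>u * mu ?w - x_of ?w $ i * s_of ?w $ i =
      (1 - a) * (\<gamma>u * mu w - x_of w $ i * s_of w $ i) + a * (\<sigma> * (\<gamma>u - 1) * mu w) + a\<^sup>2 * E"
      unfolding product_along_direction[OF d] mu' E_def by (simp add: algebra_simps)
    ultimately show ?thesis by linarith
  qed
  moreover
  have "\<bar>a\<^sup>2 * D\<bar> \<le> a * ((\<sigma> - \<gamma>p * C) * gap w)"
    using c3 mult_left_mono[OF e, of "\<sigma> - \<gamma>p * C"] par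
    by (intro quadratic_error[OF a(1) D]) linarith
  then have q: "\<bar>a\<^sup>2 * D\<bar> \<le> a * \<sigma> * gap w - a * (\<gamma>p * C * gap w)" by (simp add: algebra_simps)
  have "\<gamma>p * norm (primal_residual P ?w) \<le> gap ?w"
  proof -
    have "\<gamma>p * norm (primal_residual P ?w) \<le>
        (1 - a) * (\<gamma>p * norm (primal_residual P w)) + a * (\<gamma>p * C * gap w)"
      using mult_left_mono[OF residuals_along_direction(2)[OF d a(1,2)], of \<gamma>p] par
      by (simp add: algebra_simps)
    moreover have "(1 - a) * (\<gamma>p * norm (primal_residual P w)) \<le> (1 - a) * gap w"
      using nbhdD(5)[OF w] a by (intro mult_left_mono) auto
    ultimately show ?thesis using q unfolding gap' by linarith
  qed
  moreover have "\<gamma>d * norm (dual_residual P ?w) \<le> gap ?w"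
  proof -
    have "(1 - a) * (\<gamma>d * norm (dual_residual P w)) \<le> (1 - a) * gap w"
      using nbhdD(6)[OF w] a by (intro mult_left_mono) auto
    then have "\<gamma>d * norm (dual_residual P ?w) \<le> (1 - a) * gap w"
      unfolding residuals_along_direction(1)[OF d a(1,2)] by (simp add: mult.left_commute)
    moreover have "0 \<le> a * (\<gamma>p * C * gap w)" using a par gap_pos[OF w] by simp
    ultimately show ?thesis using q unfolding gap' by linarith
  qed
  ultimately show "?w \<in> nbhd P \<gamma>u \<gamma>l \<gamma>p \<gamma>d"
    unfolding nbhd_def pos_vec_def by blast
qed

lemma uniform_admissible_step:
  fixes P :: "('m::finite, 'n::finite) ppm"
  assumes P: "prox_rho P > 0" "prox_delta P > 0"
    and par: "0 < \<gamma>l" "\<gamma>l < 1" "1 < \<gamma>u" "\<gamma>p > 0" "\<gamma>d > 0" "0 < \<sigma>" "\<sigma> < \<sigma>bar" "0 < C" "\<gamma>p * C < \<sigma>"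
    and "\<epsilon> > 0"
  obtains a0 where "0 < a0" "a0 \<le> 1"
    "\<And>w d. w \<in> nbhd P \<gamma>u \<gamma>l \<gamma>p \<gamma>d \<Longrightarrow> \<epsilon> \<le> gap w \<Longrightarrow> gap w \<le> G \<Longrightarrow>
       inexact_newton_direction P \<sigma> C w d \<Longrightarrow> a0 \<in> admissible_steps P \<gamma>u \<gamma>l \<gamma>p \<gamma>d \<sigma>bar w d"
proof -
  obtain K1 where K1: "\<And>w. w \<in> nbhd P \<gamma>u \<gamma>l \<gamma>p \<gamma>d \<Longrightarrow> gap w \<le> G \<Longrightarrow> norm w \<le> K1"
    using nbhd_bounded[OF P par(4,5)] by blast
  obtain l where l: "l > 0" "\<And>w i. w \<in> nbhd P \<gamma>u \<gamma>l \<gamma>p \<gamma>d \<Longrightarrow> \<epsilon> \<le> gap w \<Longrightarrow> norm w \<le> K1 \<Longrightarrow>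
      l \<le> x_of w $ i \<and> l \<le> s_of w $ i"
    using nbhd_components_bounded_below[OF \<open>\<epsilon> > 0\<close> par(1)] by blast
  obtain K0 where K0: "\<And>w d. w \<in> nbhd P \<gamma>u \<gamma>l \<gamma>p \<gamma>d \<Longrightarrow> gap w \<le> G \<Longrightarrow>
      (\<And>i. l \<le> x_of w $ i) \<Longrightarrow> inexact_newton_direction P \<sigma> C w d \<Longrightarrow> norm d \<le> K0"
    using direction_bounded[OF P par(4,5,6,8) l(1)] by blast
  \<comment> \<open>Nonnegativity of \<open>K\<close> makes \<open>a * K\<close> monotone in the step \<open>a\<close>.\<close>
  define K where "K = max 0 K0"
  have small: "\<forall>\<^sub>F a in at_right 0. a * k < b" if "b > 0" for k b :: real
  proof -
    have "((\<lambda>a. a * k) \<longlongrightarrow> 0 * k) (at_right 0)" by (intro tendsto_intros)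
    then show ?thesis using that by (intro order_tendstoD(2)) auto
  qed
  have en: "\<epsilon> / real CARD('n) > 0" using \<open>\<epsilon> > 0\<close> by simp
  have "\<forall>\<^sub>F a in at_right (0::real). 0 < a \<and> a * 1 < 1 \<and> a * K < l \<and>
      a * ((1 + \<gamma>l) * K\<^sup>2) < \<sigma> * (1 - \<gamma>l) * (\<epsilon> / real CARD('n)) \<and>
      a * ((1 + \<gamma>u) * K\<^sup>2) < \<sigma> * (\<gamma>u - 1) * (\<epsilon> / real CARD('n)) \<and>
      a * K\<^sup>2 < (\<sigma> - \<gamma>p * C) * \<epsilon> \<and> a * K\<^sup>2 < (\<sigma>bar - \<sigma>) * \<epsilon>"
    using par l(1) en \<open>\<epsilon> > 0\<close>
    by (intro eventually_conj small mult_pos_pos eventually_at_right_less) auto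
  then obtain a0 where a0: "0 < a0 \<and> a0 * 1 < 1 \<and> a0 * K < l \<and>
      a0 * ((1 + \<gamma>l) * K\<^sup>2) < \<sigma> * (1 - \<gamma>l) * (\<epsilon> / real CARD('n)) \<and>
      a0 * ((1 + \<gamma>u) * K\<^sup>2) < \<sigma> * (\<gamma>u - 1) * (\<epsilon> / real CARD('n)) \<and>
      a0 * K\<^sup>2 < (\<sigma> - \<gamma>p * C) * \<epsilon> \<and> a0 * K\<^sup>2 < (\<sigma>bar - \<sigma>) * \<epsilon>"
    using eventually_happens'[OF trivial_limit_at_right_real] by blast
  have "a0 \<in> admissible_steps P \<gamma>u \<gamma>l \<gamma>p \<gamma>d \<sigma>bar w d"
    if w: "w \<in> nbhd P \<gamma>u \<gamma>l \<gamma>p \<gamma>d" "\<epsilon> \<le> gap w" "gap w \<le> G"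
      and d: "inexact_newton_direction P \<sigma> C w d" for w d
  proof -
    have lw: "l \<le> x_of w $ i \<and> l \<le> s_of w $ i" for i by (intro l(2) w K1)
    have nd: "norm d \<le> K" using K0[OF w(1,3) _ d] lw by (simp add: K_def le_max_iff_disj)
    have "w + a *\<^sub>R d \<in> nbhd P \<gamma>u \<gamma>l \<gamma>p \<gamma>d \<and> gap (w + a *\<^sub>R d) \<le> (1 - (1 - \<sigma>bar) * a) * gap w"
      if a: "a \<in> {0..a0}" for a
    proof -
      have mono: "a * k \<le> a0 * k" if "k \<ge> 0" for k using a that by (intro mult_right_mono) auto
      have "K \<ge> 0" by (simp add: K_def)
      have h: "0 \<le> a" "a \<le> 1" "a * K < l"
        "a * ((1 + \<gamma>l) * K\<^sup>2) \<le> \<sigma> * (1 - \<gamma>l) * (\<epsilon> / real CARD('n))"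
        "a * ((1 + \<gamma>u) * K\<^sup>2) \<le> \<sigma> * (\<gamma>u - 1) * (\<epsilon> / real CARD('n))"
        "a * K\<^sup>2 \<le> (\<sigma> - \<gamma>p * C) * \<epsilon>" "a * K\<^sup>2 \<le> (\<sigma>bar - \<sigma>) * \<epsilon>"
      proof -
        have "0 \<le> (1 + \<gamma>l) * K\<^sup>2" "0 \<le> (1 + \<gamma>u) * K\<^sup>2" "0 \<le> K\<^sup>2" using par by auto
        note m = mono[OF this(1)] mono[OF this(2)] mono[OF this(3)] mono[OF \<open>K \<ge> 0\<close>]
        show "0 \<le> a" "a \<le> 1" using a a0 by auto
        show "a * K < l"
          "a * ((1 + \<gamma>l) * K\<^sup>2) \<le> \<sigma> * (1 - \<gamma>l) * (\<epsilon> / real CARD('n))"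
          "a * ((1 + \<gamma>u) * K\<^sup>2) \<le> \<sigma> * (\<gamma>u - 1) * (\<epsilon> / real CARD('n))"
          "a * K\<^sup>2 \<le> (\<sigma> - \<gamma>p * C) * \<epsilon>" "a * K\<^sup>2 \<le> (\<sigma>bar - \<sigma>) * \<epsilon>"
          using m a0 by linarith+
      qed
      show ?thesis
        using short_step[OF w(1) d par nd w(2) lw h] by blast
    qed
    then show ?thesis using a0 by (auto simp: admissible_steps_def)
  qed
  then show thesis using a0 by (intro that[of a0]) auto
qed

section \<open>The largest admissible step\<close>

text \<open>
  The defining inequalities pass to the limit. If the limit has positive gap, the lower centrality
  bound keeps every product \<open>x\<^sub>i s\<^sub>i\<close> positive; if its gap is zero, both residuals vanish.
\<close>

lemma nbhd_limit:
  fixes P :: "('m::finite, 'n::finite) ppm"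
  assumes par: "\<gamma>l > 0" "\<gamma>p > 0" "\<gamma>d > 0"
    and F: "F \<noteq> bot" and lim: "(f \<longlongrightarrow> v) F" and ev: "\<forall>\<^sub>F a in F. f a \<in> nbhd P \<gamma>u \<gamma>l \<gamma>p \<gamma>d"
  shows "v \<in> nbhd P \<gamma>u \<gamma>l \<gamma>p \<gamma>d \<or> ppm_solution P v"
proof -
  have le: "g v \<le> h v" if "((\<lambda>a. g (f a)) \<longlongrightarrow> g v) F" "((\<lambda>a. h (f a)) \<longlongrightarrow> h v) F"
    "\<And>w. w \<in> nbhd P \<gamma>u \<gamma>l \<gamma>p \<gamma>d \<Longrightarrow> g w \<le> h w" for g h :: "('m, 'n) triple \<Rightarrow> real"
    by (rule tendsto_le[OF F that(2,1)]) (rule eventually_mono[OF ev that(3)])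
  note lims = tendsto_of[OF lim] tendsto_gap[OF lim] tendsto_mu[OF lim]
    tendsto_primal_residual[OF lim] tendsto_dual_residual[OF lim]
  have x: "0 \<le> x_of v $ i" and s: "0 \<le> s_of v $ i" for i
    by (rule le[of "\<lambda>_. 0"]; (intro tendsto_intros lims)?; auto dest: nbhdD intro: less_imp_le)+
  have u: "x_of v $ i * s_of v $ i \<le> \<gamma>u * mu v" for i
    by (rule le[of "\<lambda>w. x_of w $ i * s_of w $ i" "\<lambda>w. \<gamma>u * mu w"])
       ((intro tendsto_intros lims)?; auto dest: nbhdD)+
  have l: "\<gamma>l * mu v \<le> x_of v $ i * s_of v $ i" for i
    by (rule le[of "\<lambda>w. \<gamma>l * mu w" "\<lambda>w. x_of w $ i * s_of w $ i"])
       ((intro tendsto_intros lims)?; auto dest: nbhdD)+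
  have p: "\<gamma>p * norm (primal_residual P v) \<le> gap v"
    by (rule le[of "\<lambda>w. \<gamma>p * norm (primal_residual P w)" gap])
       ((intro tendsto_intros lims)?; auto dest: nbhdD)+
  have q: "\<gamma>d * norm (dual_residual P v) \<le> gap v"
    by (rule le[of "\<lambda>w. \<gamma>d * norm (dual_residual P w)" gap])
       ((intro tendsto_intros lims)?; auto dest: nbhdD)+
  show ?thesis
  proof (cases "gap v = 0")
    case True
    then have "primal_residual P v = 0" "dual_residual P v = 0"
      using p q par by (auto simp: mult_le_0_iff)
    then show ?thesis using True x s by (simp add: ppm_solution_def gap_def nonneg_vec_def)
  next
    case False
    moreover have "gap v \<ge> 0" unfolding gap_eq_sum using x s by (simp add: sum_nonneg)
    ultimately have "\<gamma>l * mu v > 0" using par by (simp add: mu_def)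
    then have "x_of v $ i * s_of v $ i > 0" for i using l[of i] by linarith
    then have "x_of v $ i > 0 \<and> s_of v $ i > 0" for i
      using x[of i] s[of i] by (metis less_le mult_eq_0_iff)
    then show ?thesis using u l p q by (simp add: nbhd_def pos_vec_def)
  qed
qed

text \<open>
  At a solution some component of \<open>x\<close> or \<open>s\<close> vanishes. If a ray reaches a solution from the interior,
  it does so at the point where it leaves the nonnegative orthant.
\<close>

lemma stopping_test_if_solution_on_ray:
  fixes P :: "('m::finite, 'n::finite) ppm"
  assumes w: "w \<in> nbhd P \<gamma>u \<gamma>l \<gamma>p \<gamma>d" and a: "a > 0" and sol: "ppm_solution P (w + a *\<^sub>R d)"
  shows "stopping_test P w d"
proof -
  define Sx where "Sx = (SUP b \<in> {b. nonneg_vec (x_of (w + b *\<^sub>R d))}. ereal b)"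
  define Ss where "Ss = (SUP b \<in> {b. nonneg_vec (s_of (w + b *\<^sub>R d))}. ereal b)"
  have nn: "nonneg_vec (x_of (w + a *\<^sub>R d))" "nonneg_vec (s_of (w + a *\<^sub>R d))"
    using sol by (auto simp: ppm_solution_def)
  have lower: "ereal a \<le> Sx" "ereal a \<le> Ss"
    unfolding Sx_def Ss_def using nn by (auto intro!: SUP_upper simp del: of_linear)
  have ray: "b \<le> a" if "0 < p" "p + a * q = 0" "0 \<le> p + b * q" for p q b :: real
  proof (rule ccontr)
    assume "\<not> b \<le> a"
    moreover have "a * q < 0" using that by linarith
    then have "q < 0" using a by (simp add: mult_less_0_iff)
    ultimately have "b * q < a * q" by simp
    then show False using that by linarith
  qed
  fix i :: 'n
  have "(\<Sum>i\<in>UNIV. x_of (w + a *\<^sub>R d) $ i * s_of (w + a *\<^sub>R d) $ i) = 0"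
    using sol by (simp add: ppm_solution_def inner_vec_def)
  moreover have "\<forall>i\<in>UNIV. 0 \<le> x_of (w + a *\<^sub>R d) $ i * s_of (w + a *\<^sub>R d) $ i"
    using nn by (simp add: nonneg_vec_def del: of_linear)
  ultimately have "x_of (w + a *\<^sub>R d) $ i * s_of (w + a *\<^sub>R d) $ i = 0"
    by (subst (asm) sum_nonneg_eq_0_iff) auto
  then consider "x_of w $ i + a * x_of d $ i = 0" | "s_of w $ i + a * s_of d $ i = 0" by auto
  then have "min Sx Ss \<le> ereal a"
  proof cases
    case 1
    have "Sx \<le> ereal a" unfolding Sx_def
      using ray[OF nbhdD(1)[OF w] 1] by (auto intro!: SUP_least simp: nonneg_vec_def)
    then show ?thesis by (simp add: min_le_iff_disj)
  next
    case 2
    have "Ss \<le> ereal a" unfolding Ss_def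
      using ray[OF nbhdD(2)[OF w] 2] by (auto intro!: SUP_least simp: nonneg_vec_def)
    then show ?thesis by (simp add: min_le_iff_disj)
  qed
  then have "step_to_boundary w d = ereal a"
    using lower unfolding step_to_boundary_def Sx_def[symmetric] Ss_def[symmetric]
    by (intro antisym) auto
  then show ?thesis using sol by (simp add: stopping_test_def)
qed

lemma maximal_step_exists:
  assumes par: "\<gamma>l > 0" "\<gamma>p > 0" "\<gamma>d > 0"
    and w: "w \<in> nbhd P \<gamma>u \<gamma>l \<gamma>p \<gamma>d" and ns: "\<not> stopping_test P w d"
  shows "\<exists>a. is_maximum (admissible_steps P \<gamma>u \<gamma>l \<gamma>p \<gamma>d \<sigma>bar w d) a"
proof -
  define T where "T = admissible_steps P \<gamma>u \<gamma>l \<gamma>p \<gamma>d \<sigma>bar w d"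
  define Q where "Q b \<longleftrightarrow> w + b *\<^sub>R d \<in> nbhd P \<gamma>u \<gamma>l \<gamma>p \<gamma>d \<and>
    gap (w + b *\<^sub>R d) \<le> (1 - (1 - \<sigma>bar) * b) * gap w" for b
  have T: "b \<in> T \<longleftrightarrow> b \<in> {0..1} \<and> (\<forall>b' \<in> {0..b}. Q b')" for b
    by (simp add: T_def admissible_steps_def Q_def)
  have "Q 0" using w by (simp add: Q_def)
  then have T0: "0 \<in> T" by (simp add: T)
  have bdd: "bdd_above T" by (rule bdd_aboveI[of _ 1]) (simp add: T)
  define a where "a = Sup T"
  have up: "b \<le> a" if "b \<in> T" for b unfolding a_def using that bdd by (rule cSup_upper)
  have a01: "0 \<le> a" "a \<le> 1"
  proof -
    show "0 \<le> a" by (rule up[OF T0])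
    show "a \<le> 1" unfolding a_def using T0 by (intro cSup_least) (blast, simp add: T)
  qed
  have below: "Q b" if b: "0 \<le> b" "b < a" for b
  proof -
    obtain c where "c \<in> T" "b < c" using less_cSupD[of T b] b(2) T0 unfolding a_def by blast
    then show ?thesis using b by (auto simp: T)
  qed
  have "Q a"
  proof (cases "a = 0")
    case True then show ?thesis using \<open>Q 0\<close> by simp
  next
    case False
    then have a: "a > 0" using a01 by simp
    have ev: "\<forall>\<^sub>F b in at_left a. Q b"
      using below unfolding eventually_at_left[OF a] by (intro exI[of _ 0]) (simp add: a)
    have lim: "((\<lambda>b. w + b *\<^sub>R d) \<longlongrightarrow> w + a *\<^sub>R d) (at_left a)" by (intro tendsto_intros)
    have "w + a *\<^sub>R d \<in> nbhd P \<gamma>u \<gamma>l \<gamma>p \<gamma>d \<or> ppm_solution P (w + a *\<^sub>R d)"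
      using ev by (intro nbhd_limit[OF par trivial_limit_at_left_real lim])
        (auto simp: Q_def elim: eventually_mono)
    moreover have "\<not> ppm_solution P (w + a *\<^sub>R d)"
      using stopping_test_if_solution_on_ray[OF w a] ns by blast
    moreover have "gap (w + a *\<^sub>R d) \<le> (1 - (1 - \<sigma>bar) * a) * gap w"
    proof (rule tendsto_le[OF trivial_limit_at_left_real _ tendsto_gap[OF lim]])
      show "((\<lambda>b. (1 - (1 - \<sigma>bar) * b) * gap w) \<longlongrightarrow> (1 - (1 - \<sigma>bar) * a) * gap w) (at_left a)"
        by (intro tendsto_intros)
      show "\<forall>\<^sub>F b in at_left a. gap (w + b *\<^sub>R d) \<le> (1 - (1 - \<sigma>bar) * b) * gap w"
        using ev by (auto simp: Q_def elim: eventually_mono)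
    qed
    ultimately show ?thesis by (simp add: Q_def)
  qed
  then have "a \<in> T" using a01 below by (auto simp: T order_le_less)
  then show ?thesis using up unfolding T_def is_maximum_def by blast
qed

section \<open>Convergence of a nonterminating run\<close>

lemma run_in_nbhd:
  assumes "nonstopping_run P \<gamma>u \<gamma>l \<gamma>p \<gamma>d \<sigma> \<sigma>bar C w"
  shows "w j \<in> nbhd P \<gamma>u \<gamma>l \<gamma>p \<gamma>d"
proof (cases j)
  case 0
  then show ?thesis using assms by (simp add: nonstopping_run_def)
next
  case (Suc k)
  then obtain d a where "a \<in> admissible_steps P \<gamma>u \<gamma>l \<gamma>p \<gamma>d \<sigma>bar (w k) d" "w j = w k + a *\<^sub>R d"
    using assms unfolding nonstopping_run_def is_maximum_def by blast
  then show ?thesis by (simp add: admissible_steps_def)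
qed

text \<open>The chosen step is maximal, so it decreases the gap at least as much as any uniform admissible step.\<close>

lemma run_gap_decrease:
  assumes run: "nonstopping_run P \<gamma>u \<gamma>l \<gamma>p \<gamma>d \<sigma> \<sigma>bar C w" and "\<sigma>bar < 1"
    and a0: "\<And>d. inexact_newton_direction P \<sigma> C (w j) d \<Longrightarrow>
      a0 \<in> admissible_steps P \<gamma>u \<gamma>l \<gamma>p \<gamma>d \<sigma>bar (w j) d"
  shows "gap (w (Suc j)) \<le> (1 - (1 - \<sigma>bar) * a0) * gap (w j)"
proof -
  obtain d a where d: "inexact_newton_direction P \<sigma> C (w j) d"
    and a: "is_maximum (admissible_steps P \<gamma>u \<gamma>l \<gamma>p \<gamma>d \<sigma>bar (w j) d) a" "w (Suc j) = w j + a *\<^sub>R d"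
    using run unfolding nonstopping_run_def by blast
  have "a0 \<le> a" using a(1) a0[OF d] by (simp add: is_maximum_def)
  then have "(1 - (1 - \<sigma>bar) * a) * gap (w j) \<le> (1 - (1 - \<sigma>bar) * a0) * gap (w j)"
    using assms(2) gap_pos[OF run_in_nbhd[OF run]]
    by (intro mult_right_mono diff_left_mono mult_left_mono) (auto intro: less_imp_le)
  moreover have "gap (w (Suc j)) \<le> (1 - (1 - \<sigma>bar) * a) * gap (w j)"
    using a by (simp add: is_maximum_def admissible_steps_def)
  ultimately show ?thesis by linarith
qed

lemma run_gap_decseq:
  assumes run: "nonstopping_run P \<gamma>u \<gamma>l \<gamma>p \<gamma>d \<sigma> \<sigma>bar C w" and "\<sigma>bar < 1"
  shows "decseq (\<lambda>j. gap (w j))"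
proof (rule decseq_SucI)
  fix j
  show "gap (w (Suc j)) \<le> gap (w j)"
    \<comment> \<open>The step \<open>0\<close> is always admissible.\<close>
    using run_gap_decrease[OF assms, of j 0] run_in_nbhd[OF run, of j]
    by (simp add: admissible_steps_def)
qed

lemma run_gap_tendsto_0:
  fixes P :: "('m::finite, 'n::finite) ppm"
  assumes P: "prox_rho P > 0" "prox_delta P > 0"
    and par: "0 < \<gamma>l" "\<gamma>l < 1" "1 < \<gamma>u" "\<gamma>p > 0" "\<gamma>d > 0" "0 < \<sigma>" "\<sigma> < \<sigma>bar" "0 < C" "\<gamma>p * C < \<sigma>"
    and sb: "\<sigma>bar < 1" and run: "nonstopping_run P \<gamma>u \<gamma>l \<gamma>p \<gamma>d \<sigma> \<sigma>bar C w"
  shows "(\<lambda>j. gap (w j)) \<longlonglongrightarrow> 0"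
proof (rule LIMSEQ_I)
  fix \<epsilon> :: real assume e: "\<epsilon> > 0"
  note dec = decseqD[OF run_gap_decseq[OF run sb]]
  note pos = gap_pos[OF run_in_nbhd[OF run]]
  have "\<exists>N. gap (w N) < \<epsilon>"
  proof (rule ccontr)
    assume "\<not> ?thesis"
    then have ge: "\<epsilon> \<le> gap (w j)" for j by (simp add: not_less)
    obtain a0 where a0: "0 < a0" "a0 \<le> 1"
      "\<And>v d. v \<in> nbhd P \<gamma>u \<gamma>l \<gamma>p \<gamma>d \<Longrightarrow> \<epsilon> \<le> gap v \<Longrightarrow> gap v \<le> gap (w 0) \<Longrightarrow>
       inexact_newton_direction P \<sigma> C v d \<Longrightarrow> a0 \<in> admissible_steps P \<gamma>u \<gamma>l \<gamma>p \<gamma>d \<sigma>bar v d"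
      using uniform_admissible_step[OF P par e] by blast
    define q where "q = 1 - (1 - \<sigma>bar) * a0"
    have "0 < (1 - \<sigma>bar) * a0" "(1 - \<sigma>bar) * a0 \<le> 1"
      using a0 sb par by (auto intro!: mult_le_one)
    then have q: "0 \<le> q" "q < 1" by (simp_all add: q_def)
    have step: "gap (w (Suc j)) \<le> q * gap (w j)" for j
      unfolding q_def using a0(3)[OF run_in_nbhd[OF run] ge dec] by (intro run_gap_decrease[OF run sb]) auto
    have geo: "gap (w j) \<le> q ^ j * gap (w 0)" for j
    proof (induction j)
      case (Suc j)
      have "gap (w (Suc j)) \<le> q * (q ^ j * gap (w 0))"
        using step[of j] mult_left_mono[OF Suc q(1)] by linarith
      then show ?case by (simp add: mult.assoc)
    qed simp
    have "(\<lambda>j. q ^ j * gap (w 0)) \<longlonglongrightarrow> 0 * gap (w 0)"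
      using q by (intro tendsto_intros LIMSEQ_power_zero) auto
    then have "\<epsilon> \<le> 0 * gap (w 0)"
      using order_trans[OF ge geo] by (intro LIMSEQ_le_const) auto
    then show False using e by simp
  qed
  then obtain N where N: "gap (w N) < \<epsilon>" by blast
  have "norm (gap (w j) - 0) < \<epsilon>" if "N \<le> j" for j
    using dec[OF that] N pos[of j] by simp
  then show "\<exists>N. \<forall>j\<ge>N. norm (gap (w j) - 0) < \<epsilon>" by blast
qed

lemma run_converges:
  fixes P :: "('m::finite, 'n::finite) ppm"
  assumes P: "prox_rho P > 0" "prox_delta P > 0" and par: "\<gamma>l > 0" "\<gamma>p > 0" "\<gamma>d > 0"
    and w: "\<And>j. w j \<in> nbhd P \<gamma>u \<gamma>l \<gamma>p \<gamma>d" and gap0: "(\<lambda>j. gap (w j)) \<longlonglongrightarrow> 0"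
  shows "\<exists>v. ppm_solution P v \<and> w \<longlonglongrightarrow> v"
proof -
  obtain G where "\<And>j. norm (gap (w j)) \<le> G"
    using convergent_imp_Bseq[OF convergentI[OF gap0]] by (auto simp: Bseq_def)
  then have G: "gap (w j) \<le> G" for j by (metis abs_le_D1 real_norm_def)
  obtain K where "\<And>v. v \<in> nbhd P \<gamma>u \<gamma>l \<gamma>p \<gamma>d \<Longrightarrow> gap v \<le> G \<Longrightarrow> norm v \<le> K"
    using nbhd_bounded[OF P par(2,3)] by blast
  then have K: "norm (w j) \<le> K" for j using w G by blast
  \<comment> \<open>Every subsequence has a further subsequence that converges to a solution.\<close>
  have cluster: "\<exists>v r'. ppm_solution P v \<and> (w \<circ> r \<circ> r') \<longlonglongrightarrow> v"
    if r: "strict_mono r" for r :: "nat \<Rightarrow> nat"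
  proof -
    have "bounded (range (w \<circ> r))" using K by (auto simp: bounded_iff)
    then obtain v r' where v: "strict_mono r'" "(w \<circ> r \<circ> r') \<longlonglongrightarrow> v"
      using bounded_imp_convergent_subsequence by blast
    have "(\<lambda>j. gap ((w \<circ> r \<circ> r') j)) \<longlonglongrightarrow> 0"
      using LIMSEQ_subseq_LIMSEQ[OF gap0 strict_mono_o[OF r v(1)]] by (simp add: o_def)
    then have "gap v = 0" using tendsto_gap[OF v(2)] LIMSEQ_unique by blast
    moreover have "v \<in> nbhd P \<gamma>u \<gamma>l \<gamma>p \<gamma>d \<or> ppm_solution P v"
      using w by (intro nbhd_limit[OF par trivial_limit_sequentially v(2)]) auto
    ultimately show ?thesis using v(2) gap_pos by fastforce
  qed
  obtain v where v: "ppm_solution P v" using cluster[of id] by (auto simp: strict_mono_def)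
  have "w \<longlonglongrightarrow> v"
  proof (rule ccontr)
    assume "\<not> w \<longlonglongrightarrow> v"
    then obtain e where e: "e > 0" "\<not> (\<forall>\<^sub>F j in sequentially. dist (w j) v < e)"
      unfolding tendsto_iff by blast
    obtain r :: "nat \<Rightarrow> nat" where r: "strict_mono r" "\<And>j. \<not> dist (w (r j)) v < e"
      using not_eventually_sequentiallyD[OF e(2)] by blast
    obtain v' r' where v': "ppm_solution P v'" "(w \<circ> r \<circ> r') \<longlonglongrightarrow> v'"
      using cluster[OF r(1)] by blast
    have "v' = v" using ppm_solution_unique[OF P v'(1) v] .
    then have "\<forall>\<^sub>F j in sequentially. dist ((w \<circ> r \<circ> r') j) v < e"
      using v'(2) e(1) by (auto simp: tendsto_iff)
    then show False using r(2) by (auto simp: eventually_sequentially)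
  qed
  then show ?thesis using v by blast
qed

theorem theorem2:
  fixes P :: "('m::finite, 'n::finite) ppm"
    and \<gamma>u \<gamma>l \<gamma>p \<gamma>d \<sigma> \<sigma>bar C :: real
  assumes "CARD('m) \<le> CARD('n)"
    and "prox_rho P > 0" and "prox_delta P > 0"
    and "0 < \<gamma>l" and "\<gamma>l < 1" and "1 < \<gamma>u"
    and "\<gamma>p > 0" and "\<gamma>d > 0"
    and "0 < \<sigma>" and "\<sigma> < \<sigma>bar" and "\<sigma>bar < 1"
    and "0 < C" and "C < 1" and "\<gamma>p * C < \<sigma>"
  shows
    "(\<forall>w \<in> nbhd P \<gamma>u \<gamma>l \<gamma>p \<gamma>d.
        (\<exists>d. inexact_newton_direction P \<sigma> C w d) \<and>
        (\<forall>d. inexact_newton_direction P \<sigma> C w d \<and> \<not> stopping_test P w d \<longrightarrow>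
             (\<exists>\<alpha>. is_maximum (admissible_steps P \<gamma>u \<gamma>l \<gamma>p \<gamma>d \<sigma>bar w d) \<alpha>))) \<and>
     (\<forall>w. nonstopping_run P \<gamma>u \<gamma>l \<gamma>p \<gamma>d \<sigma> \<sigma>bar C w \<longrightarrow>
        (\<forall>j. w j \<in> nbhd P \<gamma>u \<gamma>l \<gamma>p \<gamma>d) \<and>
        (\<lambda>j. x_of (w j) \<bullet> s_of (w j)) \<longlonglongrightarrow> 0 \<and>
        (\<exists>w_sol. ppm_solution P w_sol \<and> w \<longlonglongrightarrow> w_sol))"
proof (intro conjI ballI allI impI)
  fix w assume "w \<in> nbhd P \<gamma>u \<gamma>l \<gamma>p \<gamma>d"
  then show "\<exists>d. inexact_newton_direction P \<sigma> C w d"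
    using newton_direction_exists assms by blast
next
  fix w d assume "w \<in> nbhd P \<gamma>u \<gamma>l \<gamma>p \<gamma>d" "inexact_newton_direction P \<sigma> C w d \<and> \<not> stopping_test P w d"
  then show "\<exists>\<alpha>. is_maximum (admissible_steps P \<gamma>u \<gamma>l \<gamma>p \<gamma>d \<sigma>bar w d) \<alpha>"
    using maximal_step_exists assms by blast
next
  fix w j assume "nonstopping_run P \<gamma>u \<gamma>l \<gamma>p \<gamma>d \<sigma> \<sigma>bar C w"
  then show "w j \<in> nbhd P \<gamma>u \<gamma>l \<gamma>p \<gamma>d" by (rule run_in_nbhd)
next
  fix w assume run: "nonstopping_run P \<gamma>u \<gamma>l \<gamma>p \<gamma>d \<sigma> \<sigma>bar C w"
  have gap0: "(\<lambda>j. gap (w j)) \<longlonglongrightarrow> 0"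
    by (rule run_gap_tendsto_0[OF _ _ _ _ _ _ _ _ _ _ _ _ run]) (use assms in auto)
  then show "(\<lambda>j. x_of (w j) \<bullet> s_of (w j)) \<longlonglongrightarrow> 0" by (simp add: gap_def)
  show "\<exists>w_sol. ppm_solution P w_sol \<and> w \<longlonglongrightarrow> w_sol"
    by (rule run_converges[OF _ _ _ _ _ run_in_nbhd[OF run] gap0]) (use assms in auto)
qed

end
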